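(* For all integers $n\geq 3$ and $p\geq 0$, $$\mathcal{A}(C_{n}\cup pK_1)<\mathcal{A}(H_{3,n-3}\cup pK_1).$$
   Context: Graphs are finite and simple. For a graph $G$ and an integer $k$, $S(G,k)$ is the number of partitions of the vertex set of $G$ into exactly $k$ nonempty stable sets (sets of pairwise non-adjacent vertices). Put $\mathcal{B}(G)=\sum_{k}S(G,k)$, $\mathcal{T}(G)=\sum_{k}k\,S(G,k)$ and $\mathcal{A}(G)=\mathcal{T}(G)/\mathcal{B}(G)$ (the average number of colors in the non-equivalent colorings of $G$). $P_n$ and $C_n$ are the path and the cycle on $n$ vertices. For $m\geq 3$ and $r\geq 0$, $H_{m,r}$ is the graph on $m+r$ vertices obtained from the disjoint union of $C_m$ and $P_r$ by linking (with an edge) one extremity of $P_r$ to one vertex of $C_m$; $H_{m,0}=C_m$. $G\cup pK_1$ is the graph obtained from $G$ by adding $p$ isolated vertices.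
   Formalization: The formal theorem assumes n ≥ 4 instead of n ≥ 3: at n = 3 the two graphs coincide, since H_{3,0} = C_3, so the strict inequality is false there for every p. *)

theory Defs
  imports Complex_Main "HOL-Library.Disjoint_Sets"
begin

record 'a graph =
  verts :: "'a set"
  edges :: "'a set set"

definition simple_graph :: "'a graph \<Rightarrow> bool" where
  "simple_graph G \<longleftrightarrow> finite (verts G) \<and> (\<forall>e\<in>edges G. e \<subseteq> verts G \<and> card e = 2)"

definition stable :: "'a graph \<Rightarrow> 'a set \<Rightarrow> bool" where
  "stable G A \<longleftrightarrow> A \<subseteq> verts G \<and> (\<forall>u\<in>A. \<forall>v\<in>A. {u, v} \<notin> edges G)"

text \<open>Nonemptiness of the blocks is part of \<^const>\<open>partition_on\<close>.\<close>

definition stable_partitions :: "'a graph \<Rightarrow> nat \<Rightarrow> 'a set set set" where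
  "stable_partitions G k =
     {P. partition_on (verts G) P \<and> card P = k \<and> (\<forall>A\<in>P. stable G A)}"

definition num_colorings :: "'a graph \<Rightarrow> nat \<Rightarrow> nat" where
  "num_colorings G k = card (stable_partitions G k)"

text \<open>
  A partition of a finite set has at most as many blocks as the set has elements, so
  cutting the sums off at the number of vertices loses nothing.
\<close>

definition total_colorings :: "'a graph \<Rightarrow> nat" where
  "total_colorings G = (\<Sum>k\<le>card (verts G). num_colorings G k)"

definition total_colors :: "'a graph \<Rightarrow> nat" where
  "total_colors G = (\<Sum>k\<le>card (verts G). k * num_colorings G k)"

definition avg_colors :: "'a graph \<Rightarrow> real" where
  "avg_colors G = real (total_colors G) / real (total_colorings G)"

definition path_graph :: "nat \<Rightarrow> nat graph" where
  "path_graph n = \<lparr>verts = {..<n}, edges = {{i, Suc i} | i. Suc i < n}\<rparr>"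

text \<open>Meant for \<open>n \<ge> 3\<close> only: for \<open>n = 1\<close> the formula gives a loop, for \<open>n = 2\<close> a single edge.\<close>

definition cycle_graph :: "nat \<Rightarrow> nat graph" where
  "cycle_graph n = \<lparr>verts = {..<n}, edges = {{i, Suc i mod n} | i. i < n}\<rparr>"

definition edgeless_graph :: "nat \<Rightarrow> nat graph" where
  "edgeless_graph p = \<lparr>verts = {..<p}, edges = {}\<rparr>"

definition disjoint_union :: "'a graph \<Rightarrow> 'b graph \<Rightarrow> ('a + 'b) graph" where
  "disjoint_union G H =
     \<lparr>verts = verts G <+> verts H,
      edges = (`) Inl ` edges G \<union> (`) Inr ` edges H\<rparr>"

definition add_isolated :: "'a graph \<Rightarrow> nat \<Rightarrow> ('a + nat) graph" where
  "add_isolated G p = disjoint_union G (edgeless_graph p)"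

text \<open>
  The cycle on \<open>m\<close> vertices with a pendant path on \<open>r\<close> vertices. For \<open>r = 0\<close> there is no
  extremity to link, and the graph is a copy of the cycle.
\<close>

definition H_graph :: "nat \<Rightarrow> nat \<Rightarrow> (nat + nat) graph" where
  "H_graph m r =
     (let U = disjoint_union (cycle_graph m) (path_graph r)
      in \<lparr>verts = verts U,
          edges = edges U \<union> (if r = 0 then {} else {{Inl 0, Inr 0}})\<rparr>)"

lemma simple_graph_disjoint_union:
  assumes "simple_graph G" "simple_graph H"
  shows "simple_graph (disjoint_union G H)"
  using assms
  by (auto simp: simple_graph_def disjoint_union_def card_image inj_on_def)

lemma simple_graph_path: "simple_graph (path_graph n)"
  by (auto simp: simple_graph_def path_graph_def)

lemma simple_graph_cycle:
  assumes "n \<ge> 3"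
  shows "simple_graph (cycle_graph n)"
proof -
  have "Suc i mod n \<noteq> i" if "i < n" for i
    using that assms by (cases "Suc i = n") auto
  moreover have "Suc i mod n < n" for i
    using assms by simp
  ultimately show ?thesis
    by (fastforce simp: simple_graph_def cycle_graph_def card_insert_if)
qed

lemma simple_graph_add_isolated:
  "simple_graph G \<Longrightarrow> simple_graph (add_isolated G p)"
  unfolding add_isolated_def
  by (rule simple_graph_disjoint_union) (auto simp: simple_graph_def edgeless_graph_def)

lemma simple_graph_H_graph:
  assumes "m \<ge> 3"
  shows "simple_graph (H_graph m r)"
proof -
  have "simple_graph (disjoint_union (cycle_graph m) (path_graph r))"
    using assms by (intro simple_graph_disjoint_union simple_graph_cycle simple_graph_path)
  then show ?thesis
    using assms
    by (auto simp: simple_graph_def H_graph_def disjoint_union_def cycle_graph_def path_graph_def)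
qed

lemma num_colorings_eq_0:
  assumes "finite (verts G)" "k > card (verts G)"
  shows "num_colorings G k = 0"
proof -
  have "card P \<le> card (verts G)" if P: "partition_on (verts G) P" for P
  proof -
    have fin: "finite P" using P assms(1) by (rule finite_elements[rotated])
    have blk: "finite A \<and> A \<noteq> {}" if "A \<in> P" for A
      using that P assms(1) by (metis partition_onD1 partition_onD3 Union_upper finite_subset)
    have "card P = (\<Sum>A\<in>P. 1)" by simp
    also have "\<dots> \<le> (\<Sum>A\<in>P. card A)"
      using blk by (intro sum_mono) (simp add: Suc_leI card_gt_0_iff)
    also have "\<dots> = card (\<Union>P)"
      using P blk by (intro card_Union_disjoint[symmetric]) (auto simp: partition_on_def disjoint_def pairwise_def disjnt_def)
    also have "\<Union>P = verts G" using partition_onD1[OF P] by simp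
    finally show ?thesis .
  qed
  then have "stable_partitions G k = {}"
    using assms(2) by (fastforce simp: stable_partitions_def)
  then show ?thesis by (simp add: num_colorings_def)
qed

text \<open>Isomorphic graphs have the same colouring numbers.\<close>

lemma stable_partitions_image:
  assumes inj: "inj_on f (verts G)" and V: "verts H = f ` verts G"
    and E: "edges H = (`) f ` edges G" and sub: "edges G \<subseteq> Pow (verts G)"
    and P: "P \<in> stable_partitions G k"
  shows "(`) f ` P \<in> stable_partitions H k"
proof -
  have part: "partition_on (verts G) P" and cP: "card P = k"
    and st: "\<And>A. A \<in> P \<Longrightarrow> stable G A"
    using P by (auto simp: stable_partitions_def)
  have Psub: "P \<subseteq> Pow (verts G)" using part by (auto simp: partition_on_def)
  have "inj_on ((`) f) P"
    using inj_on_image_Pow[OF inj] Psub by (rule inj_on_subset)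
  then have "card ((`) f ` P) = k" using cP by (simp add: card_image)
  moreover have "partition_on (verts H) ((`) f ` P)"
  proof (rule partition_onI)
    show "\<Union> ((`) f ` P) = verts H"
      using partition_onD1[OF part] V by (simp add: image_Union[symmetric])
    show "{} \<notin> (`) f ` P"
      using part by (auto simp: partition_on_def)
    show "disjnt p p'" if pp: "p \<in> (`) f ` P" "p' \<in> (`) f ` P" "p \<noteq> p'" for p p'
    proof -
      from pp obtain A B where AB: "A \<in> P" "B \<in> P" "p = f ` A" "p' = f ` B" by auto
    have "A \<noteq> B" using pp(3) AB by auto
      then have "A \<inter> B = {}" using partition_onD2[OF part] AB by (auto simp: disjoint_def)
    then have "f ` A \<inter> f ` B = {}"
      using inj_on_image_Int[OF inj, of A B] AB Psub by auto
    then show ?thesis using AB by (simp add: disjnt_def)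
    qed
  qed
  moreover have "stable H (f ` A)" if A: "A \<in> P" for A
  proof -
    have AV: "A \<subseteq> verts G" using A Psub by auto
    have "{f u, f v} \<notin> edges H" if uv: "u \<in> A" "v \<in> A" for u v
    proof
      assume "{f u, f v} \<in> edges H"
      then obtain e where e: "e \<in> edges G" "f ` {u, v} = f ` e" using E by auto
      have "{u, v} = e"
        using inj_on_image_eq_iff[OF inj, of "{u, v}" e] e uv AV sub by auto
      then show False using st[OF A] e uv by (auto simp: stable_def)
    qed
    then show ?thesis using AV V by (auto simp: stable_def)
  qed
  ultimately show ?thesis by (auto simp: stable_partitions_def)
qed

lemma avg_colors_iso:
  assumes inj: "inj_on f (verts G)" and V: "verts H = f ` verts G"
    and E: "edges H = (`) f ` edges G" and sub: "edges G \<subseteq> Pow (verts G)"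
  shows "avg_colors H = avg_colors G"
proof -
  let ?g = "inv_into (verts G) f"
  have inj': "inj_on ?g (verts H)" using V by (simp add: inj_on_inv_into)
  have V': "verts G = ?g ` verts H" using inj V by (simp add: inv_into_image_cancel)
  have cancel: "?g ` f ` A = A" if "A \<subseteq> verts G" for A
    using inj that by (rule inv_into_image_cancel)
  have E': "edges G = (`) ?g ` edges H"
  proof -
    have "(`) ?g ` edges H = (\<lambda>e. ?g ` f ` e) ` edges G" by (simp add: E image_image)
    also have "\<dots> = id ` edges G" using cancel sub by (intro image_cong) auto
    finally show ?thesis by simp
  qed
  have sub': "edges H \<subseteq> Pow (verts H)" unfolding V E using sub by blast
  have "num_colorings H k = num_colorings G k" for k
  proof -
    have "bij_betw ((`) ((`) f)) (stable_partitions G k) (stable_partitions H k)"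
    proof (rule bij_betw_byWitness[where f' = "(`) ((`) ?g)"])
      show "\<forall>P\<in>stable_partitions G k. (`) ?g ` (`) f ` P = P"
      proof
        fix P assume "P \<in> stable_partitions G k"
        then have "\<And>A. A \<in> P \<Longrightarrow> A \<subseteq> verts G"
          by (auto simp: stable_partitions_def stable_def)
        then show "(`) ?g ` (`) f ` P = P" using cancel by (force simp: image_image)
      qed
      show "\<forall>P\<in>stable_partitions H k. (`) f ` (`) ?g ` P = P"
      proof
        fix P assume "P \<in> stable_partitions H k"
        then have "\<And>A. A \<in> P \<Longrightarrow> A \<subseteq> f ` verts G"
          using V by (auto simp: stable_partitions_def stable_def)
        then have "\<And>A. A \<in> P \<Longrightarrow> f ` ?g ` A = A"
          by (simp add: image_inv_into_cancel)
        then show "(`) f ` (`) ?g ` P = P" by (force simp: image_image)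
      qed
      show "(`) ((`) f) ` stable_partitions G k \<subseteq> stable_partitions H k"
        using stable_partitions_image[OF assms] by auto
      show "(`) ((`) ?g) ` stable_partitions H k \<subseteq> stable_partitions G k"
        using stable_partitions_image[OF inj' V' E' sub'] by auto
    qed
    then show ?thesis by (simp add: num_colorings_def bij_betw_same_card)
  qed
  moreover have "card (verts H) = card (verts G)" using inj V by (simp add: card_image)
  ultimately show ?thesis
    by (simp add: avg_colors_def total_colors_def total_colorings_def)
qed

text \<open>
  With no pendant path the two graphs coincide up to renaming, so a strict comparison of
  \<open>C\<^sub>n\<close> with \<open>H\<^bsub>3,n-3\<^esub>\<close> can only hold from \<open>n = 4\<close> on.
\<close>

lemma avg_colors_H_graph_0:
  assumes "m \<ge> 3"
  shows "avg_colors (add_isolated (H_graph m 0) p) = avg_colors (add_isolated (cycle_graph m) p)"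
proof (rule avg_colors_iso)
  let ?f = "map_sum Inl id :: nat + nat \<Rightarrow> (nat + nat) + nat"
  show "inj_on ?f (verts (add_isolated (cycle_graph m) p))"
    by (rule inj_on_subset[OF sum.inj_map]) auto
  show "verts (add_isolated (H_graph m 0) p) = ?f ` verts (add_isolated (cycle_graph m) p)"
    by (simp add: add_isolated_def disjoint_union_def H_graph_def path_graph_def Plus_def
        image_Un image_image)
  show "edges (add_isolated (H_graph m 0) p) = (`) ?f ` edges (add_isolated (cycle_graph m) p)"
    by (simp add: add_isolated_def disjoint_union_def H_graph_def path_graph_def
        edgeless_graph_def image_image)
  show "edges (add_isolated (cycle_graph m) p) \<subseteq> Pow (verts (add_isolated (cycle_graph m) p))"
    using simple_graph_add_isolated[OF simple_graph_cycle[OF assms]]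
    by (auto simp: simple_graph_def)
qed

end

theory Submission
  imports Defs "HOL-Library.FuncSet"
begin

text \<open>
  The number \<open>\<chi>\<^sub>G(x)\<close> of proper colourings of \<open>G\<close> with colours below \<open>x\<close> is the sum over \<open>k\<close> of
  \<open>S(G, k) x(x-1)\<cdots>(x-k+1)\<close>. By Dobinski's formula, summing \<open>\<chi>\<^sub>G(x) / x!\<close> and \<open>x \<chi>\<^sub>G(x) / x!\<close> over
  all \<open>x\<close> gives \<open>e B(G)\<close> and \<open>e (T(G) + B(G))\<close>, so \<open>A(G) + 1\<close> is the mean of \<open>x\<close> under the weights
  \<open>\<chi>\<^sub>G(x) / x!\<close>. Hence \<open>A(G) < A(H)\<close> as soon as the ratio \<open>\<chi>\<^sub>H(x) / \<chi>\<^sub>G(x)\<close> is nondecreasing and not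
  constant. For the two graphs at hand the ratio, with \<open>u = x - 1\<close>, is
  \<open>(u\<^sup>n - u\<^bsup>n-2\<^esup>) / (u\<^sup>n + (-1)\<^sup>n u)\<close>; the isolated vertices cancel.
\<close>

section \<open>Proper colourings as functions\<close>

text \<open>Colourings are \<open>undefined\<close> off the vertex set, so each is counted once. The
  case \<open>u = v\<close> is included: a loop excludes every colouring, on which the cycle
  recursion relies at C_1.\<close>

definition colorings :: "'a graph \<Rightarrow> nat \<Rightarrow> ('a \<Rightarrow> nat) set" where
  "colorings G x = {f \<in> verts G \<rightarrow>\<^sub>E {..<x}. \<forall>u v. {u, v} \<in> edges G \<longrightarrow> f u \<noteq> f v}"

lemma finite_colorings: "finite (verts G) \<Longrightarrow> finite (colorings G x)"
  by (rule finite_subset[of _ "verts G \<rightarrow>\<^sub>E {..<x}"]) (auto simp: colorings_def finite_PiE)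

text \<open>The falling factorial x(x-1)...(x-k+1), in the shape of the library's count of
  injections. Truncated subtraction does no harm: for k > x the factor x - x is already
  zero.\<close>

definition falling :: "nat \<Rightarrow> nat \<Rightarrow> nat" where
  "falling k x = prod ((-) x) {0..<k}"

lemma falling_Suc: "falling (Suc k) x = falling k x * (x - k)"
  by (simp add: falling_def)

lemma falling_eq_0: "x < k \<Longrightarrow> falling k x = 0"
  unfolding falling_def by (rule prod_zero) auto

lemma falling_fact: "k \<le> x \<Longrightarrow> falling k x * fact (x - k) = fact x"
proof (induction k)
  case (Suc k)
  then have "fact (x - k) = (x - k) * fact (x - Suc k)"
    by (metis Suc_diff_Suc Suc_le_lessD fact_Suc of_nat_id)
  with Suc show ?case by (simp add: falling_Suc mult.assoc)
qed (simp add: falling_def)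

lemma card_injections:
  assumes "finite P"
  shows "card {g \<in> P \<rightarrow>\<^sub>E {..<x}. inj_on g P} = falling (card P) x"
  using card_inj_on_subset_funcset[OF assms, of "{..<x}" P] by (simp add: falling_def)

text \<open>For a proper colouring \<open>f\<close> of a graph on \<open>V\<close>, these are the
  colour classes.\<close>

definition kernel :: "'a set \<Rightarrow> ('a \<Rightarrow> 'b) \<Rightarrow> 'a set set" where
  "kernel V f = (\<lambda>v. {w \<in> V. f w = f v}) ` V"

lemma partition_on_kernel: "partition_on V (kernel V f)"
  by (rule partition_onI) (auto simp: kernel_def disjnt_def)

text \<open>Such a function amounts to an injective choice of one value per block: compose the
  choice with the map \<open>b\<close> from a point to its block.\<close>

lemma card_functions_with_kernel:
  assumes P: "partition_on V P" and fin: "finite V"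
  shows "card {f \<in> V \<rightarrow>\<^sub>E {..<x::nat}. kernel V f = P} = falling (card P) x"
proof -
  have "\<forall>v\<in>V. \<exists>A. A \<in> P \<and> v \<in> A"
    using partition_onD1[OF P] by auto
  then obtain b where b: "\<And>v. v \<in> V \<Longrightarrow> b v \<in> P \<and> v \<in> b v" by metis
  have PV: "A \<subseteq> V" if "A \<in> P" for A using partition_onD1[OF P] that by auto
  have ne: "\<exists>v. v \<in> A" if "A \<in> P" for A using partition_onD3[OF P] that by (metis ex_in_conv)
  have buniq: "b v = A" if "A \<in> P" "v \<in> A" for A v
    using that b[of v] PV partition_onD2[OF P] unfolding disjoint_def by blast
  let ?I = "{g \<in> P \<rightarrow>\<^sub>E {..<x}. inj_on g P}"
  let ?F = "\<lambda>g. \<lambda>v\<in>V. g (b v) :: nat"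
  have "bij_betw ?F ?I {f \<in> V \<rightarrow>\<^sub>E {..<x}. kernel V f = P}"
  proof (rule bij_betw_imageI)
    show "inj_on ?F ?I"
    proof (rule inj_onI)
      fix g h assume g: "g \<in> ?I" and h: "h \<in> ?I" and eq: "?F g = ?F h"
      have "g A = h A" if A: "A \<in> P" for A
      proof -
        obtain v where v: "v \<in> A" using ne A by blast
        with fun_cong[OF eq, of v] PV[OF A] buniq[OF A v] show ?thesis by auto
      qed
      with g h show "g = h" by (auto intro: PiE_ext)
    qed
    show "?F ` ?I = {f \<in> V \<rightarrow>\<^sub>E {..<x}. kernel V f = P}"
    proof (intro equalityI subsetI)
      fix f assume "f \<in> ?F ` ?I"
      then obtain g where g: "g \<in> ?I" "f = ?F g" by blast
      have "{w \<in> V. f w = f v} = b v" if v: "v \<in> V" for v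
      proof -
        have "{w \<in> V. f w = f v} = {w \<in> V. b w = b v}"
          using g v b inj_on_eq_iff[of g P] by auto
        also have "\<dots> = b v" using b v PV buniq by blast
        finally show ?thesis .
      qed
      then have "kernel V f = b ` V" by (simp add: kernel_def)
      also have "\<dots> = P"
        using b buniq ne PV by (auto simp: image_iff) (metis subsetD)
      finally show "f \<in> {f \<in> V \<rightarrow>\<^sub>E {..<x}. kernel V f = P}" using g b by auto
    next
      fix f assume "f \<in> {f \<in> V \<rightarrow>\<^sub>E {..<x}. kernel V f = P}"
      then have f: "f \<in> V \<rightarrow>\<^sub>E {..<x}" and k: "kernel V f = P" by auto
      have same: "f v = f w \<longleftrightarrow> b v = b w" if "v \<in> V" "w \<in> V" for v w
      proof -
        have "{u \<in> V. f u = f w} \<in> P" using that unfolding k[symmetric] kernel_def by blast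
        then have "b w = {u \<in> V. f u = f w}" using that by (intro buniq) auto
        then have "f v = f w \<longleftrightarrow> v \<in> b w" using that by blast
        also have "\<dots> \<longleftrightarrow> b v = b w" using that b buniq by blast
        finally show ?thesis .
      qed
      \<comment> \<open>The value on a block is read off at an arbitrary representative; by
        \<open>same\<close> the choice does not matter, and distinct blocks get distinct
        values.\<close>
      define g where "g = (\<lambda>A\<in>P. f (SOME v. v \<in> A))"
      have some: "(SOME v. v \<in> A) \<in> A" if "A \<in> P" for A using someI_ex[OF ne[OF that]] .
      have gb: "g (b v) = f v" if "v \<in> V" for v
      proof -
        have bv: "b v \<in> P" using b[OF that] by blast
        let ?w = "SOME w. w \<in> b v"
        have "b ?w = b v" using buniq[OF bv some[OF bv]] .
        moreover have "?w \<in> V" using some[OF bv] PV[OF bv] by blast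
        ultimately show ?thesis using same[of ?w v] that bv by (simp add: g_def)
      qed
      have "g \<in> P \<rightarrow>\<^sub>E {..<x}" using f some PV by (auto simp: g_def PiE_iff subset_iff)
      moreover have "inj_on g P"
      proof (rule inj_onI)
        fix A B assume AB: "A \<in> P" "B \<in> P" "g A = g B"
        obtain v w where vw: "v \<in> A" "w \<in> B" using ne AB by blast
        then have "v \<in> V" "w \<in> V" "b v = A" "b w = B" using AB PV buniq by blast+
        then show "A = B" using AB(3) gb[of v] gb[of w] same[of v w] by simp
      qed
      moreover have "f = ?F g" using f gb by (auto simp: fun_eq_iff PiE_def extensional_def)
      ultimately show "f \<in> ?F ` ?I" by blast
    qed
  qed
  then show ?thesis
    using card_injections[OF finite_elements[OF fin P], of x] by (simp add: bij_betw_same_card)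
qed

text \<open>An edge is monochromatic exactly when both its ends lie in one class of the kernel.
  Simplicity keeps the ends inside the vertex set.\<close>

lemma colorings_iff_kernel_stable:
  assumes "simple_graph G" "f \<in> verts G \<rightarrow>\<^sub>E {..<x}"
  shows "f \<in> colorings G x \<longleftrightarrow> (\<forall>A\<in>kernel (verts G) f. stable G A)"
proof -
  have "u \<in> verts G \<and> v \<in> verts G" if "{u, v} \<in> edges G" for u v
    using that assms(1) unfolding simple_graph_def by blast
  then have "f \<in> colorings G x \<longleftrightarrow>
      (\<forall>u\<in>verts G. \<forall>v\<in>verts G. f u = f v \<longrightarrow> {u, v} \<notin> edges G)"
    using assms(2) unfolding colorings_def by blast
  also have "\<dots> \<longleftrightarrow> (\<forall>A\<in>kernel (verts G) f. stable G A)"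
    unfolding kernel_def stable_def by auto
  finally show ?thesis .
qed

lemma card_partition_le:
  assumes "partition_on V P" "finite V"
  shows "card P \<le> card V"
proof -
  have fin: "finite A" if "A \<in> P" for A
    using assms that by (metis partition_onD1 Union_upper finite_subset)
  have "card P = (\<Sum>A\<in>P. 1)" by simp
  also have "\<dots> \<le> (\<Sum>A\<in>P. card A)"
    using fin partition_onD3[OF assms(1)] by (intro sum_mono) (metis Suc_leI One_nat_def card_gt_0_iff)
  also have "\<dots> = card V" using product_partition[OF assms(1) fin] by simp
  finally show ?thesis .
qed

text \<open>Sort the colourings by their partition into colour classes. This is the chromatic
  polynomial expanded in falling factorials.\<close>

lemma card_colorings:
  assumes G: "simple_graph G"
  shows "card (colorings G x) = (\<Sum>k\<le>card (verts G). num_colorings G k * falling k x)"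
proof -
  let ?V = "verts G"
  let ?F = "\<lambda>P. {f \<in> ?V \<rightarrow>\<^sub>E {..<x}. kernel ?V f = P}"
  have fin: "finite ?V" using G by (simp add: simple_graph_def)
  have finF: "finite (?F P)" for P
    by (rule finite_subset[of _ "?V \<rightarrow>\<^sub>E {..<x}"]) (auto simp: finite_PiE fin)
  have finS: "finite (stable_partitions G k)" for k
    by (rule finite_subset[OF _ finitely_many_partition_on[OF fin]])
      (auto simp: stable_partitions_def)
  define SP where "SP = (\<Union>k\<le>card ?V. stable_partitions G k)"
  have SP: "P \<in> SP \<longleftrightarrow> partition_on ?V P \<and> (\<forall>A\<in>P. stable G A)" for P
    using card_partition_le[OF _ fin] by (auto simp: SP_def stable_partitions_def)
  have "f \<in> colorings G x \<longleftrightarrow> f \<in> (\<Union>P\<in>SP. ?F P)" for f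
  proof (cases "f \<in> ?V \<rightarrow>\<^sub>E {..<x}")
    case True
    with partition_on_kernel[of ?V f] show ?thesis
      by (simp add: colorings_iff_kernel_stable[OF G True] SP)
  qed (auto simp: colorings_def)
  then have "colorings G x = (\<Union>P\<in>SP. ?F P)" by blast
  also have "card \<dots> = (\<Sum>P\<in>SP. card (?F P))"
    using finS finF by (intro card_UN_disjoint) (auto simp: SP_def)
  also have "\<dots> = (\<Sum>P\<in>SP. falling (card P) x)"
    using card_functions_with_kernel[OF _ fin] by (intro sum.cong) (auto simp: SP)
  also have "\<dots> = (\<Sum>k\<le>card ?V. \<Sum>P\<in>stable_partitions G k. falling (card P) x)"
    unfolding SP_def using finS by (intro sum.UNION_disjoint) (auto simp: stable_partitions_def)
  also have "\<dots> = (\<Sum>k\<le>card ?V. num_colorings G k * falling k x)"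
    by (intro sum.cong) (auto simp: num_colorings_def stable_partitions_def)
  finally show ?thesis .
qed

section \<open>Dobinski's formula and the comparison criterion\<close>

text \<open>The terms with x < k vanish and the others equal 1/(x-k)!, so this is the exponential
  series shifted by k.\<close>

lemma falling_sums: "(\<lambda>x. real (falling k x) / fact x) sums exp 1"
proof -
  have "(\<lambda>i. real (falling k (i + k)) / fact (i + k)) = (\<lambda>i. 1 ^ i /\<^sub>R fact i)"
  proof
    fix i
    have "falling k (i + k) * fact i = (fact (i + k) :: nat)" using falling_fact[of k "i + k"] by simp
    then have "real (falling k (i + k)) * fact i = fact (i + k)"
      by (metis of_nat_fact of_nat_mult)
    then show "real (falling k (i + k)) / fact (i + k) = 1 ^ i /\<^sub>R fact i"
      by (simp add: field_simps)
  qed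
  then have "(\<lambda>i. real (falling k (i + k)) / fact (i + k)) sums exp 1"
    using exp_converges[of "1::real"] by simp
  then show ?thesis by (subst (asm) sums_zero_iff_shift) (auto simp: falling_eq_0)
qed

text \<open>Write x = (x - k) + k. This reduces the first moment to two instances of
  \<open>falling_sums\<close>.\<close>

lemma times_falling: "x * falling k x = falling (Suc k) x + k * falling k x"
proof (cases "k \<le> x")
  case True
  then obtain d where "x = k + d" using le_iff_add by blast
  then show ?thesis by (simp add: falling_Suc algebra_simps)
qed (simp add: falling_eq_0)

lemma times_falling_sums: "(\<lambda>x. real (x * falling k x) / fact x) sums ((real k + 1) * exp 1)"
proof -
  have "(\<lambda>x. real (falling (Suc k) x) / fact x + real k * (real (falling k x) / fact x))
          sums (exp 1 + real k * exp 1)"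
    by (intro sums_add sums_mult falling_sums)
  then show ?thesis
    unfolding times_falling by (simp add: add_divide_distrib algebra_simps)
qed

lemma dobinski_total_colorings:
  assumes "simple_graph G"
  shows "(\<lambda>x. real (card (colorings G x)) / fact x) sums (real (total_colorings G) * exp 1)"
proof -
  have "(\<lambda>x. \<Sum>k\<le>card (verts G). real (num_colorings G k) * (real (falling k x) / fact x))
          sums (\<Sum>k\<le>card (verts G). real (num_colorings G k) * exp 1)"
    by (intro sums_sum sums_mult falling_sums)
  then show ?thesis
    by (simp add: card_colorings[OF assms] total_colorings_def sum_distrib_right sum_divide_distrib)
qed

text \<open>The first moment of each falling factorial carries the factor k + 1 instead of k, whence
  the extra \<open>total_colorings G\<close>.\<close>

lemma dobinski_total_colors:
  assumes "simple_graph G"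
  shows "(\<lambda>x. real x * (real (card (colorings G x)) / fact x))
           sums (real (total_colors G + total_colorings G) * exp 1)"
proof -
  have "(\<lambda>x. \<Sum>k\<le>card (verts G). real (num_colorings G k) * (real (x * falling k x) / fact x))
          sums (\<Sum>k\<le>card (verts G). real (num_colorings G k) * ((real k + 1) * exp 1))"
    by (intro sums_sum sums_mult times_falling_sums)
  moreover have "(\<Sum>k\<le>card (verts G). real (num_colorings G k) * (real (x * falling k x) / fact x))
      = real x * (real (card (colorings G x)) / fact x)" for x
    by (simp add: card_colorings[OF assms] sum_distrib_left sum_divide_distrib ac_simps)
  moreover have "(\<Sum>k\<le>card (verts G). real (num_colorings G k) * ((real k + 1) * exp 1))
      = real (total_colors G + total_colorings G) * exp 1"
    by (simp add: total_colorings_def total_colors_def sum_distrib_left sum_distrib_right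
        distrib_left distrib_right sum.distrib ac_simps)
  ultimately show ?thesis by simp
qed

text \<open>The partition into singletons is always stable. Positivity allows clearing the
  denominators of \<open>avg_colors\<close>.\<close>

lemma total_colorings_pos:
  assumes "simple_graph G"
  shows "total_colorings G > 0"
proof -
  let ?P = "(\<lambda>v. {v}) ` verts G"
  have fin: "finite (verts G)" using assms by (simp add: simple_graph_def)
  have "{v} \<notin> edges G" for v using assms by (force simp: simple_graph_def)
  then have "?P \<in> stable_partitions G (card (verts G))"
    using partition_on_singletons[of "verts G"]
    by (auto simp: stable_partitions_def stable_def card_image)
  moreover have "finite (stable_partitions G (card (verts G)))"
    by (rule finite_subset[OF _ finitely_many_partition_on[OF fin]])
      (auto simp: stable_partitions_def)
  ultimately have "num_colorings G (card (verts G)) > 0"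
    unfolding num_colorings_def card_gt_0_iff by blast
  then show ?thesis unfolding total_colorings_def by (subst sum_pos2) auto
qed

text \<open>Chebyshev's sum inequality: twice the finite double sum below is a sum of nonnegative terms.\<close>

lemma sums_likelihood_ratio_less:
  fixes a b :: "nat \<Rightarrow> real"
  assumes mono: "\<And>x y. y < x \<Longrightarrow> a y * b x \<le> a x * b y"
    and strict: "y0 < x0" "a y0 * b x0 < a x0 * b y0"
    and A: "a sums A" and A1: "(\<lambda>x. real x * a x) sums A1"
    and B: "b sums B" and B1: "(\<lambda>x. real x * b x) sums B1"
  shows "A * B1 < A1 * B"
proof -
  define t where "t x y = (real x - real y) * (a x * b y - a y * b x)" for x y
  have t_nonneg: "t x y \<ge> 0" for x y
    unfolding t_def using mono[of x y] mono[of y x]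
    by (cases x y rule: linorder_cases) (auto intro: mult_nonneg_nonneg mult_nonpos_nonpos)
  have t_pos: "t x0 y0 > 0" using strict by (simp add: t_def)
  define S where "S N = (\<Sum>x<N. real x * a x) * (\<Sum>y<N. b y) - (\<Sum>x<N. a x) * (\<Sum>y<N. real y * b y)"
    for N
  have S_eq: "2 * S N = (\<Sum>x<N. \<Sum>y<N. t x y)" for N
  proof -
    have 1: "S N = (\<Sum>x<N. \<Sum>y<N. (real x - real y) * (a x * b y))"
      unfolding S_def sum_product by (simp flip: sum_subtractf add: algebra_simps)
    have 2: "S N = (\<Sum>x<N. \<Sum>y<N. (real y - real x) * (a y * b x))"
      unfolding 1 by (rule sum.swap)
    have "2 * S N = S N + S N" by simp
    also have "\<dots> = (\<Sum>x<N. \<Sum>y<N. (real x - real y) * (a x * b y))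
        + (\<Sum>x<N. \<Sum>y<N. (real y - real x) * (a y * b x))"
      by (simp only: 1[symmetric] 2[symmetric])
    also have "\<dots> = (\<Sum>x<N. \<Sum>y<N. t x y)"
      by (simp add: t_def algebra_simps flip: sum.distrib)
    finally show ?thesis .
  qed
  \<comment> \<open>The limit preserves only weak inequalities; a positive lower bound independent
    of N keeps the result strict.\<close>
  have "t x0 y0 \<le> 2 * S N" if "N > x0" for N
  proof -
    have "t x0 y0 \<le> (\<Sum>y<N. t x0 y)"
      using that strict by (intro member_le_sum t_nonneg) auto
    also have "\<dots> \<le> (\<Sum>x<N. \<Sum>y<N. t x y)"
      using that by (intro member_le_sum[where f = "\<lambda>x. \<Sum>y<N. t x y"] sum_nonneg t_nonneg) auto
    finally show ?thesis by (simp add: S_eq)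
  qed
  then have "\<forall>\<^sub>F N in sequentially. t x0 y0 / 2 \<le> S N"
    by (intro eventually_sequentiallyI[of "Suc x0"]) (simp add: Suc_le_eq mult.commute)
  moreover have "S \<longlonglongrightarrow> A1 * B - A * B1"
    unfolding S_def using A A1 B B1 by (intro tendsto_intros) (auto simp: sums_def)
  ultimately have "t x0 y0 / 2 \<le> A1 * B - A * B1"
    by (intro tendsto_lowerbound) auto
  with t_pos show ?thesis by simp
qed

text \<open>The ratio condition is cross-multiplied so that vanishing counts are allowed. The
  factorial weights contribute the same factor to both sides.\<close>

lemma avg_colors_less:
  assumes G: "simple_graph G" and H: "simple_graph H"
    and mono: "\<And>x y. y < x \<Longrightarrow>
      card (colorings H y) * card (colorings G x) \<le> card (colorings H x) * card (colorings G y)"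
    and strict: "y0 < x0"
      "card (colorings H y0) * card (colorings G x0) < card (colorings H x0) * card (colorings G y0)"
  shows "avg_colors G < avg_colors H"
proof -
  let ?c = "\<lambda>x. real (card (colorings G x)) / fact x"
  let ?h = "\<lambda>x. real (card (colorings H x)) / fact x"
  let ?B = "\<lambda>G. real (total_colorings G)" and ?T = "\<lambda>G. real (total_colors G)"
  have "?B H * exp 1 * (real (total_colors G + total_colorings G) * exp 1)
      < real (total_colors H + total_colorings H) * exp 1 * (?B G * exp 1)"
  proof (rule sums_likelihood_ratio_less[where a = ?h and b = ?c])
    show "?h y * ?c x \<le> ?h x * ?c y" if "y < x" for x y
      using mono[OF that] by (simp add: divide_simps mult.commute flip: of_nat_mult)
    show "?h y0 * ?c x0 < ?h x0 * ?c y0"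
      using strict(2) by (simp add: divide_simps mult.commute flip: of_nat_mult)
  qed (use strict dobinski_total_colorings dobinski_total_colors G H in auto)
  \<comment> \<open>The common product of the two values of \<open>total_colorings\<close> cancels;
    this removes the shift by 1 in both means.\<close>
  then have "exp 1 * exp 1 * (?B H * ?T G) < exp 1 * exp 1 * (?B G * ?T H)"
    by (simp add: algebra_simps)
  then have "?B H * ?T G < ?B G * ?T H" by simp
  then show ?thesis
    using total_colorings_pos[OF G] total_colorings_pos[OF H]
    by (simp add: avg_colors_def divide_simps mult.commute)
qed

section \<open>Chromatic polynomials\<close>

text \<open>A colouring extends to \<open>w\<close> by any colour absent from \<open>N\<close>, so
  only the number of colours seen on \<open>N\<close> matters.\<close>

lemma colorings_insert_vertex:
  assumes G: "simple_graph G" and w: "w \<notin> verts G" and N: "N \<subseteq> verts G"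
    and V: "verts G' = insert w (verts G)"
    and E: "edges G' = edges G \<union> (\<lambda>u. {w, u}) ` N"
  shows "card (colorings G' x) = (\<Sum>f\<in>colorings G x. x - card (f ` N))"
proof -
  have sub: "u \<in> verts G \<and> v \<in> verts G" if "{u, v} \<in> edges G" for u v
    using that G unfolding simple_graph_def by blast
  have fin: "finite (verts G)" using G by (simp add: simple_graph_def)
  let ?S = "Sigma (colorings G x) (\<lambda>f. {..<x} - f ` N)"
  have E': "{u, v} \<in> edges G' \<longleftrightarrow> {u, v} \<in> edges G \<or> u = w \<and> v \<in> N \<or> v = w \<and> u \<in> N" for u v
    unfolding E by (auto simp: doubleton_eq_iff)
  have "bij_betw (\<lambda>(f, c). f(w := c)) ?S (colorings G' x)"
  proof (rule bij_betw_byWitness[where f' = "\<lambda>g. (g(w := undefined), g w)"])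
    show "\<forall>p\<in>?S. (\<lambda>g. (g(w := undefined), g w)) ((\<lambda>(f, c). f(w := c)) p) = p"
      using w by (auto simp: colorings_def fun_eq_iff PiE_def extensional_def)
    show "(\<lambda>(f, c). f(w := c)) ` ?S \<subseteq> colorings G' x"
    proof clarify
      fix f c assume f: "f \<in> colorings G x" and c: "c < x" "c \<notin> f ` N"
      have "(f(w := c)) u \<noteq> (f(w := c)) v" if "{u, v} \<in> edges G'" for u v
        using that f c sub[of u v] w N unfolding E' by (auto simp: colorings_def)
      then show "f(w := c) \<in> colorings G' x"
        using f c(1) by (auto simp: colorings_def V PiE_def extensional_def)
    qed
    show "(\<lambda>g. (g(w := undefined), g w)) ` colorings G' x \<subseteq> ?S"
    proof clarify
      fix g assume g: "g \<in> colorings G' x"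
      then have "g \<in> insert w (verts G) \<rightarrow>\<^sub>E {..<x}"
        and e: "\<And>u v. {u, v} \<in> edges G' \<Longrightarrow> g u \<noteq> g v"
        by (auto simp: colorings_def V)
      then have "g(w := undefined) \<in> verts G \<rightarrow>\<^sub>E {..<x}" "g w < x"
        using w by (auto simp: PiE_def extensional_def)
      moreover have "(g(w := undefined)) u \<noteq> (g(w := undefined)) v" if "{u, v} \<in> edges G" for u v
        using sub[OF that] w e[of u v] that unfolding E' by auto
      moreover have "g w \<notin> (g(w := undefined)) ` N"
      proof -
        have "g w \<noteq> g v" if "v \<in> N" for v using e[of w v] that unfolding E' by blast
        then show ?thesis using w N by auto
      qed
      ultimately show "g(w := undefined) \<in> colorings G x \<and> g w \<in> {..<x} - (g(w := undefined)) ` N"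
        by (auto simp: colorings_def)
    qed
  qed auto
  then have "card (colorings G' x) = card ?S" by (simp add: bij_betw_same_card)
  also have "\<dots> = (\<Sum>f\<in>colorings G x. card ({..<x} - f ` N))"
    using finite_colorings[OF fin] by (intro card_SigmaI) auto
  also have "\<dots> = (\<Sum>f\<in>colorings G x. x - card (f ` N))"
  proof (rule sum.cong[OF refl])
    fix f assume "f \<in> colorings G x"
    then have "f ` N \<subseteq> {..<x}" using N by (auto simp: colorings_def)
    then show "card ({..<x} - f ` N) = x - card (f ` N)"
      by (subst card_Diff_subset) (auto intro: finite_subset)
  qed
  finally show ?thesis .
qed

lemma colorings_insert_leaf:
  assumes "simple_graph G" "w \<notin> verts G" "u \<in> verts G"
    and "verts G' = insert w (verts G)" "edges G' = insert {w, u} (edges G)"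
  shows "card (colorings G' x) = (x - 1) * card (colorings G x)"
  by (subst colorings_insert_vertex[OF assms(1,2) _ assms(4), where N = "{u}"])
    (use assms in auto)

lemma colorings_disjoint_union:
  fixes G :: "'a graph" and H :: "'b graph"
  assumes "simple_graph G" "simple_graph H"
  shows "card (colorings (disjoint_union G H) x) = card (colorings G x) * card (colorings H x)"
proof -
  let ?U = "disjoint_union G H"
  have E: "{Inl u, Inl v} \<in> edges ?U \<longleftrightarrow> {u, v} \<in> edges G"
    "{Inr u', Inr v'} \<in> edges ?U \<longleftrightarrow> {u', v'} \<in> edges H"
    "{Inl u, Inr v'} \<notin> edges ?U" "{Inr v', Inl u} \<notin> edges ?U" for u v u' v'
  proof -
    have l: "{Inl u, Inl v} = (Inl :: 'a \<Rightarrow> 'a + 'b) ` e \<longleftrightarrow> {u, v} = e" for e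
      using inj_image_eq_iff[OF inj_Inl, of "{u, v}" e] by simp
    have r: "{Inr u', Inr v'} = (Inr :: 'b \<Rightarrow> 'a + 'b) ` e \<longleftrightarrow> {u', v'} = e" for e
      using inj_image_eq_iff[OF inj_Inr, of "{u', v'}" e] by simp
    show "{Inl u, Inl v} \<in> edges ?U \<longleftrightarrow> {u, v} \<in> edges G"
      using l by (auto simp: disjoint_union_def image_iff)
    show "{Inr u', Inr v'} \<in> edges ?U \<longleftrightarrow> {u', v'} \<in> edges H"
      using r by (auto simp: disjoint_union_def image_iff)
    show "{Inl u, Inr v'} \<notin> edges ?U" "{Inr v', Inl u} \<notin> edges ?U"
      by (auto simp: disjoint_union_def)
  qed
  have "bij_betw (\<lambda>(f, g). case_sum f g) (colorings G x \<times> colorings H x) (colorings ?U x)"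
  proof (rule bij_betw_byWitness[where f' = "\<lambda>h. (h \<circ> Inl, h \<circ> Inr)"])
    show "\<forall>h\<in>colorings ?U x. (\<lambda>(f, g). case_sum f g) (h \<circ> Inl, h \<circ> Inr) = h"
      by (auto simp: fun_eq_iff split: sum.split)
    show "(\<lambda>(f, g). case_sum f g) ` (colorings G x \<times> colorings H x) \<subseteq> colorings ?U x"
    proof clarify
      fix f g assume f: "f \<in> colorings G x" and g: "g \<in> colorings H x"
      have "case_sum f g \<in> verts ?U \<rightarrow>\<^sub>E {..<x}"
        using f g by (auto simp: colorings_def disjoint_union_def PiE_def extensional_def
            split: sum.split)
      moreover have "case_sum f g a \<noteq> case_sum f g b" if "{a, b} \<in> edges ?U" for a b
        using that f g by (cases a; cases b) (auto simp: E colorings_def)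
      ultimately show "case_sum f g \<in> colorings ?U x" by (simp add: colorings_def)
    qed
    show "(\<lambda>h. (h \<circ> Inl, h \<circ> Inr)) ` colorings ?U x \<subseteq> colorings G x \<times> colorings H x"
    proof clarify
      fix h assume "h \<in> colorings ?U x"
      then have h: "h \<in> verts ?U \<rightarrow>\<^sub>E {..<x}" and e: "\<And>u v. {u, v} \<in> edges ?U \<Longrightarrow> h u \<noteq> h v"
        by (auto simp: colorings_def)
      have "h (Inl a) = undefined" if "a \<notin> verts G" for a
        using PiE_arb[OF h, of "Inl a"] that by (auto simp: disjoint_union_def)
      moreover have "h (Inr a) = undefined" if "a \<notin> verts H" for a
        using PiE_arb[OF h, of "Inr a"] that by (auto simp: disjoint_union_def)
      ultimately have "h \<circ> Inl \<in> verts G \<rightarrow>\<^sub>E {..<x}" "h \<circ> Inr \<in> verts H \<rightarrow>\<^sub>E {..<x}"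
        using h by (auto simp: disjoint_union_def PiE_def extensional_def)
      then show "h \<circ> Inl \<in> colorings G x \<and> h \<circ> Inr \<in> colorings H x"
        using e by (auto simp: colorings_def E)
    qed
  qed auto
  then show ?thesis by (simp add: bij_betw_same_card[symmetric] card_cartesian_product)
qed

lemma colorings_add_isolated:
  assumes "simple_graph G"
  shows "card (colorings (add_isolated G p) x) = card (colorings G x) * x ^ p"
proof -
  have "colorings (edgeless_graph p) x = {..<p} \<rightarrow>\<^sub>E {..<x}"
    by (simp add: colorings_def edgeless_graph_def)
  then have "card (colorings (edgeless_graph p) x) = x ^ p"
    by (simp add: card_funcsetE)
  moreover have "simple_graph (edgeless_graph p)"
    by (simp add: simple_graph_def edgeless_graph_def)
  ultimately show ?thesis
    using assms by (simp add: add_isolated_def colorings_disjoint_union)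
qed

section \<open>Paths, cycles, and the triangle with a tail\<close>

lemma edges_path_graph_Suc: "edges (path_graph (Suc (Suc n))) = insert {Suc n, n} (edges (path_graph (Suc n)))"
  by (auto simp: path_graph_def less_Suc_eq doubleton_eq_iff)

lemma colorings_path: "card (colorings (path_graph (Suc n)) x) = x * (x - 1) ^ n"
proof (induction n)
  case 0
  have "colorings (path_graph (Suc 0)) x = {..<Suc 0} \<rightarrow>\<^sub>E {..<x}"
    by (simp add: colorings_def path_graph_def)
  then show ?case by (simp add: card_funcsetE)
next
  case (Suc n)
  have "card (colorings (path_graph (Suc (Suc n))) x) = (x - 1) * card (colorings (path_graph (Suc n)) x)"
    by (rule colorings_insert_leaf[OF simple_graph_path, where w = "Suc n" and u = n])
      (use edges_path_graph_Suc in \<open>auto simp: path_graph_def\<close>)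
  with Suc show ?case by simp
qed

text \<open>Only the last index wraps around. For \<open>n = 0\<close> the closing edge is the loop
  at \<open>0\<close>.\<close>

lemma edges_cycle_graph: "edges (cycle_graph (Suc n)) = insert {n, 0} (edges (path_graph (Suc n)))"
proof -
  have "edges (cycle_graph (Suc n)) = (\<lambda>i. {i, Suc i mod Suc n}) ` {..<Suc n}"
    by (auto simp: cycle_graph_def)
  also have "\<dots> = insert {n, 0} ((\<lambda>i. {i, Suc i mod Suc n}) ` {..<n})"
    by (simp add: lessThan_Suc)
  also have "(\<lambda>i. {i, Suc i mod Suc n}) ` {..<n} = (\<lambda>i. {i, Suc i}) ` {..<n}"
    by (intro image_cong) auto
  also have "\<dots> = edges (path_graph (Suc n))" by (auto simp: path_graph_def)
  finally show ?thesis .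
qed

lemma colorings_cycle_eq:
  "colorings (cycle_graph (Suc n)) x = {f \<in> colorings (path_graph (Suc n)) x. f n \<noteq> f 0}"
proof -
  have "verts (cycle_graph (Suc n)) = verts (path_graph (Suc n))"
    by (simp add: cycle_graph_def path_graph_def)
  then show ?thesis
    by (auto simp: colorings_def edges_cycle_graph doubleton_eq_iff)
qed

text \<open>Deletion--contraction, with \<open>C\<^sub>1\<close> a loop and \<open>C\<^sub>2\<close> a single edge.\<close>

lemma colorings_cycle_Suc:
  "card (colorings (cycle_graph (Suc (Suc n))) (Suc u)) + card (colorings (cycle_graph (Suc n)) (Suc u))
     = u * card (colorings (path_graph (Suc n)) (Suc u))"
proof -
  let ?P = "colorings (path_graph (Suc n)) (Suc u)"
  have fin: "finite ?P" by (rule finite_colorings) (simp add: path_graph_def)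
  \<comment> \<open>The longer cycle is the path plus a vertex joined to both ends. Equal ends leave
    u colours for it; distinct ends leave u - 1, and the path colouring then also colours the
    shorter cycle.\<close>
  have "card (colorings (cycle_graph (Suc (Suc n))) (Suc u)) = (\<Sum>f\<in>?P. Suc u - card (f ` {n, 0}))"
    by (rule colorings_insert_vertex[OF simple_graph_path, where w = "Suc n"])
      (auto simp: edges_cycle_graph edges_path_graph_Suc, auto simp: cycle_graph_def path_graph_def)
  moreover have "card (colorings (cycle_graph (Suc n)) (Suc u)) = (\<Sum>f\<in>?P. if f n \<noteq> f 0 then 1 else 0)"
    unfolding colorings_cycle_eq using fin by (simp add: sum.If_cases Int_def)
  moreover have "(Suc u - card (f ` {n, 0})) + (if f n \<noteq> f 0 then 1 else 0) = u"
    if "f \<in> ?P" for f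
  proof (cases "f n = f 0")
    case False
    \<comment> \<open>Two distinct colours force u to be positive, so the truncated difference
      \<open>Suc u - 2\<close> plus 1 is indeed u.\<close>
    have "f n < Suc u" "f 0 < Suc u" using that by (auto simp: colorings_def path_graph_def)
    with False have "u \<ge> 1" by linarith
    with False show ?thesis by (simp add: card_insert_if)
  qed simp
  ultimately show ?thesis by (simp flip: sum.distrib add: mult.commute)
qed

text \<open>Solves the recursion with right-hand side u (u + 1) u^n, starting from the loop, which
  has no colouring. Using \<open>Suc u\<close> colours avoids truncated subtraction, and integers
  accommodate the sign.\<close>

lemma colorings_cycle:
  "int (card (colorings (cycle_graph (Suc n)) (Suc u))) = int u ^ Suc n + (- 1) ^ Suc n * int u"
proof (induction n)
  case 0
  then show ?case by (simp add: colorings_cycle_eq)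
next
  case (Suc n)
  have "int (card (colorings (cycle_graph (Suc (Suc n))) (Suc u)))
      = int u * (int (Suc u) * int u ^ n) - int (card (colorings (cycle_graph (Suc n)) (Suc u)))"
    using arg_cong[OF colorings_cycle_Suc[of n u], of int]
    by (simp add: colorings_path algebra_simps)
  then show ?case unfolding Suc by (simp add: algebra_simps)
qed

text \<open>The triangle contributes u^3 - u, and each vertex of the tail is attached as a leaf,
  contributing a factor u.\<close>

lemma colorings_H_graph_3:
  "int (card (colorings (H_graph 3 r) (Suc u))) = (int u ^ 3 - int u) * int u ^ r"
proof (induction r)
  case 0
  have "H_graph 3 0 = disjoint_union (cycle_graph 3) (path_graph 0)"
    by (simp add: H_graph_def disjoint_union_def)
  moreover have "colorings (path_graph 0) (Suc u) = {\<lambda>_. undefined}"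
    by (simp add: colorings_def path_graph_def)
  ultimately show ?case
    using colorings_cycle[of 2 u] simple_graph_cycle[of 3] simple_graph_path[of 0]
    by (simp add: colorings_disjoint_union numeral_3_eq_3)
next
  case (Suc r)
  \<comment> \<open>The neighbour of the new leaf: the triangle vertex that carries the tail, or the
    current end of the tail.\<close>
  let ?u = "if r = 0 then Inl 0 else Inr (r - 1) :: nat + nat"
  have V: "verts (H_graph 3 k) = {..<3} <+> {..<k}" for k
    by (simp add: H_graph_def disjoint_union_def cycle_graph_def path_graph_def)
  have "edges (H_graph 3 (Suc r)) = insert {Inr r, ?u} (edges (H_graph 3 r))"
  proof (cases r)
    case 0
    then show ?thesis
      by (auto simp: H_graph_def disjoint_union_def path_graph_def)
  next
    case (Suc k)
    then show ?thesis
      by (auto simp: H_graph_def disjoint_union_def edges_path_graph_Suc)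
  qed
  then have "card (colorings (H_graph 3 (Suc r)) (Suc u)) = (Suc u - 1) * card (colorings (H_graph 3 r) (Suc u))"
    by (intro colorings_insert_leaf[OF simple_graph_H_graph, where w = "Inr r" and u = ?u])
      (auto simp: V)
  then show ?case using Suc by simp
qed

section \<open>Monotonicity of the ratio and the comparison\<close>

lemma colorings_0: "verts G \<noteq> {} \<Longrightarrow> colorings G 0 = {}"
  by (auto simp: colorings_def PiE_eq_empty_iff)

text \<open>Here u and v are numbers of colours minus 1, and \<epsilon> is the sign in the cycle
  polynomial. The bound \<open>m \<ge> 1\<close> is essential: for m = 0 and \<epsilon> = -1 both
  sides coincide.\<close>

lemma ratio_increasing:
  fixes u v \<epsilon> :: int
  assumes "2 \<le> v" "v < u" "m \<ge> 1" "\<epsilon> = 1 \<or> \<epsilon> = - 1"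
  shows "(v ^ 3 - v) * v ^ m * (u ^ (m + 3) + \<epsilon> * u) < (u ^ 3 - u) * u ^ m * (v ^ (m + 3) + \<epsilon> * v)"
proof -
  have um: "u ^ m \<ge> v ^ m" using assms by (intro power_mono) auto
  have vm: "v ^ m \<ge> v" using assms by (intro self_le_power) auto
  have uv: "u\<^sup>2 > v\<^sup>2" using assms by (intro power_strict_mono) auto
  define X where "X = u ^ m"
  define Y where "Y = v ^ m"
  have X: "X \<ge> Y" "Y \<ge> v" "Y > 0" "X > 0" using um vm assms by (auto simp: X_def Y_def)
  \<comment> \<open>This is the difference of the two sides divided by u v.\<close>
  have "X * Y * (u\<^sup>2 - v\<^sup>2) + \<epsilon> * (X * (u\<^sup>2 - 1) - Y * (v\<^sup>2 - 1)) > 0"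
    using assms(4)
  proof
    assume "\<epsilon> = 1"
    have "Y * (v\<^sup>2 - 1) \<le> X * (u\<^sup>2 - 1)"
      using X uv assms by (intro mult_mono) (auto simp: one_le_power)
    moreover have "X * Y * (u\<^sup>2 - v\<^sup>2) > 0" using X uv by simp
    ultimately show ?thesis using \<open>\<epsilon> = 1\<close> by simp
  next
    assume "\<epsilon> = - 1"
    \<comment> \<open>From v + 1 \<le> u follows v (u^2 - v^2) > u^2 - 1. As Y \<ge> v, the leading
      term then outweighs the negative term X (u^2 - 1).\<close>
    have "(v + 1)\<^sup>2 * (v - 1) \<le> u\<^sup>2 * (v - 1)"
      using assms by (intro mult_right_mono power_mono) auto
    also have "(v + 1)\<^sup>2 * (v - 1) = v * v\<^sup>2 + v * v - v - 1"
      by (simp add: power2_eq_square algebra_simps)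
    finally have "v * v\<^sup>2 + v * v - v - 1 \<le> u\<^sup>2 * v - u\<^sup>2"
      by (simp add: right_diff_distrib)
    moreover have "v * v \<ge> 2 * v" using assms by (intro mult_right_mono) auto
    moreover have "v * (u\<^sup>2 - v\<^sup>2) = u\<^sup>2 * v - v * v\<^sup>2" by (simp add: algebra_simps)
    ultimately have "v * (u\<^sup>2 - v\<^sup>2) > u\<^sup>2 - 1"
      using assms by linarith
    moreover have "v * (u\<^sup>2 - v\<^sup>2) \<le> Y * (u\<^sup>2 - v\<^sup>2)"
      using X uv by (intro mult_right_mono) auto
    ultimately have "X * (u\<^sup>2 - 1) < X * (Y * (u\<^sup>2 - v\<^sup>2))"
      using X by (intro mult_strict_left_mono) auto
    moreover have "Y * (v\<^sup>2 - 1) \<ge> 0" using X assms by (simp add: one_le_power)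
    ultimately show ?thesis using \<open>\<epsilon> = - 1\<close> by (simp add: algebra_simps)
  qed
  then have "u * v * (X * Y * (u\<^sup>2 - v\<^sup>2) + \<epsilon> * (X * (u\<^sup>2 - 1) - Y * (v\<^sup>2 - 1))) > 0"
    using assms by (intro mult_pos_pos) auto
  also have "u * v * (X * Y * (u\<^sup>2 - v\<^sup>2) + \<epsilon> * (X * (u\<^sup>2 - 1) - Y * (v\<^sup>2 - 1)))
      = (u ^ 3 - u) * X * (Y * v ^ 3 + \<epsilon> * v) - (v ^ 3 - v) * Y * (X * u ^ 3 + \<epsilon> * u)"
    by (simp add: power2_eq_square power3_eq_cube algebra_simps)
  finally show ?thesis by (simp add: X_def Y_def power_add)
qed

text \<open>For \<open>n = 3\<close> both graphs are a triangle with isolated vertices and the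
  averages agree, so strictness starts at \<open>n = 4\<close>, where the tail is nonempty.\<close>

theorem theorem15:
  fixes n p :: nat
  assumes "n \<ge> 4"
  shows "avg_colors (add_isolated (cycle_graph n) p)
       < avg_colors (add_isolated (H_graph 3 (n - 3)) p)"
proof -
  define m where "m = n - 3"
  have n: "n = Suc (m + 2)" and m: "m \<ge> 1" using assms by (auto simp: m_def)
  let ?c = "\<lambda>x. card (colorings (cycle_graph n) x)"
  let ?h = "\<lambda>x. card (colorings (H_graph 3 m) x)"
  have G: "simple_graph (cycle_graph n)" and H: "simple_graph (H_graph 3 m)"
    using assms simple_graph_cycle simple_graph_H_graph by auto
  have c: "int (?c (Suc u)) = int u ^ (m + 3) + (- 1) ^ n * int u" for u
    unfolding n colorings_cycle by (simp add: numeral_3_eq_3)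
  have h: "int (?h (Suc u)) = (int u ^ 3 - int u) * int u ^ m" for u
    by (rule colorings_H_graph_3)
  \<comment> \<open>A triangle needs three colours. Hence the smaller side of the cross-multiplied
    condition vanishes for y \<le> 2, and \<open>ratio_increasing\<close> is needed only from three
    colours on.\<close>
  have h_small: "?h x = 0" if "x \<le> 2" for x
  proof (cases x)
    case 0
    then show ?thesis
      by (simp add: colorings_0 H_graph_def disjoint_union_def cycle_graph_def lessThan_empty_iff)
  next
    case (Suc u)
    with that have "u = 0 \<or> u = 1" by auto
    then show ?thesis using h[of u] Suc by auto
  qed
  have less: "?h y * ?c x < ?h x * ?c y" if xy: "2 < y" "y < x" for x y
  proof -
    obtain u v where uv: "x = Suc u" "y = Suc v" using xy by (cases x; cases y) auto
    have "int (?h y) * int (?c x) < int (?h x) * int (?c y)"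
      unfolding uv c h
    proof (rule ratio_increasing)
      show "(2::int) \<le> int v" "int v < int u" using xy uv by simp_all
      show "(- 1 :: int) ^ n = 1 \<or> (- 1 :: int) ^ n = - 1" by (simp add: minus_one_power_iff)
    qed (rule m)
    then show ?thesis by (simp flip: of_nat_mult)
  qed
  have "avg_colors (add_isolated (cycle_graph n) p) < avg_colors (add_isolated (H_graph 3 m) p)"
  proof (rule avg_colors_less)
    show "simple_graph (add_isolated (cycle_graph n) p)" "simple_graph (add_isolated (H_graph 3 m) p)"
      using G H by (simp_all add: simple_graph_add_isolated)
    have mono: "?h y * ?c x \<le> ?h x * ?c y" if "y < x" for x y
      using less[of y x] h_small[of y] that by (cases "y \<le> 2") auto
    \<comment> \<open>The isolated vertices multiply both sides by the same factor
      \<open>x ^ p * y ^ p\<close>.\<close>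
    show "card (colorings (add_isolated (H_graph 3 m) p) y) * card (colorings (add_isolated (cycle_graph n) p) x)
        \<le> card (colorings (add_isolated (H_graph 3 m) p) x) * card (colorings (add_isolated (cycle_graph n) p) y)"
      if "y < x" for x y
      using mult_le_mono1[OF mono[OF that], of "x ^ p * y ^ p"]
      by (simp only: colorings_add_isolated G H ac_simps)
    \<comment> \<open>The two smallest numbers of colours to which \<open>less\<close> applies
      witness strictness.\<close>
    show "(3::nat) < 4" by simp
    show "card (colorings (add_isolated (H_graph 3 m) p) 3) * card (colorings (add_isolated (cycle_graph n) p) 4)
        < card (colorings (add_isolated (H_graph 3 m) p) 4) * card (colorings (add_isolated (cycle_graph n) p) 3)"
      using less[of 3 4] by (simp add: colorings_add_isolated G H ac_simps)
  qed
  then show ?thesis by (simp add: m_def)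
qed

end
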